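(* Let $L:=\operatorname{arsinh}1=\log(1+\sqrt2)$. For every integer $m\ge0$, $$\sum_{r=0}^{\infty}\frac{\binom{4r}{2r}}{16^r(4r+1)}\,t_{2r}(\{2\}^m)=\frac{\pi^{2m+1}+(-1)^m(2L)^{2m+1}}{2^{2m+2}(2m+1)!},$$ $$\sum_{r=0}^{\infty}\frac{\binom{4r+2}{2r+1}}{2^{4r+2}(4r+3)}\,t_{2r+1}(\{2\}^m)=\frac{\pi^{2m+1}-(-1)^m(2L)^{2m+1}}{2^{2m+2}(2m+1)!}.$$ For every integer $m\ge1$, $$\sum_{r=1}^{\infty}\frac{16^r}{r^2\binom{4r}{2r}}\,\zeta_{2r-1}(\{2\}^{m-1})=\frac{2\{\pi^{2m}+(-1)^m(2L)^{2m}\}}{(2m)!},$$ $$\sum_{r=0}^{\infty}\frac{4^{2r+1}}{(2r+1)^2\binom{4r+2}{2r+1}}\,\zeta_{2r}(\{2\}^{m-1})=\frac{\pi^{2m}-(-1)^m(2L)^{2m}}{2(2m)!}.$$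
   Context: For integers $n\ge0$, $m\ge0$, the finite repeated-$2$ sums are $$\zeta_n(\{2\}^m):=\sum_{n\ge n_1>\cdots>n_m\ge1}\frac1{n_1^2\cdots n_m^2},\qquad t_n(\{2\}^m):=\sum_{n\ge n_1>\cdots>n_m\ge1}\frac1{(2n_1-1)^2\cdots(2n_m-1)^2},$$ with the value $1$ when $m=0$ and the value $0$ when $m>n$. *)

theory Defs
  imports Complex_Main
begin

text \<open>Tuples \<open>n \<ge> n\<^sub>1 > \<dots> > n\<^sub>m \<ge> 1\<close>, written as strictly decreasing lists.\<close>

definition decreasing_tuples :: "nat \<Rightarrow> nat \<Rightarrow> nat list set" where
  "decreasing_tuples n m = {ns. length ns = m \<and> sorted_wrt (>) ns \<and> set ns \<subseteq> {1..n}}"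

text \<open>The second argument is the number \<open>m\<close> of repeated entries 2: \<open>zeta_fin n m\<close> stands for
  \<open>\<zeta>\<^sub>n({2}\<^sup>m)\<close> and \<open>t_fin n m\<close> for \<open>t\<^sub>n({2}\<^sup>m)\<close>.\<close>

definition zeta_fin :: "nat \<Rightarrow> nat \<Rightarrow> real" where
  "zeta_fin n m = (\<Sum>ns\<in>decreasing_tuples n m. \<Prod>k\<leftarrow>ns. 1 / (real k)\<^sup>2)"

definition t_fin :: "nat \<Rightarrow> nat \<Rightarrow> real" where
  "t_fin n m = (\<Sum>ns\<in>decreasing_tuples n m. \<Prod>k\<leftarrow>ns. 1 / (2 * real k - 1)\<^sup>2)"

lemma finite_decreasing_tuples [simp]: "finite (decreasing_tuples n m)"
proof (rule finite_subset)
  show "decreasing_tuples n m \<subseteq> {ns. set ns \<subseteq> {1..n} \<and> length ns = m}"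
    by (auto simp: decreasing_tuples_def)
qed (simp add: finite_lists_length_eq)

lemma decreasing_tuples_0 [simp]: "decreasing_tuples n 0 = {[]}"
  by (auto simp: decreasing_tuples_def)

lemma decreasing_tuples_empty:
  assumes "n < m"
  shows "decreasing_tuples n m = {}"
proof -
  have "length ns \<le> n" if "sorted_wrt (>) ns" "set ns \<subseteq> {1..n}" for ns :: "nat list"
  proof -
    have "sorted_wrt (<) (rev ns)"
      using that(1) by (simp add: sorted_wrt_rev)
    then have "distinct ns"
      by (simp add: strict_sorted_iff)
    then have "length ns = card (set ns)"
      by (simp add: distinct_card)
    also have "\<dots> \<le> card {1..n}"
      using that(2) by (intro card_mono) auto
    finally show ?thesis by simp
  qed
  then show ?thesis
    using assms by (fastforce simp: decreasing_tuples_def)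
qed

lemma fin_sums_0 [simp]: "zeta_fin n 0 = 1" "t_fin n 0 = 1"
  by (simp_all add: zeta_fin_def t_fin_def)

lemma fin_sums_eq_0: "n < m \<Longrightarrow> zeta_fin n m = 0" "n < m \<Longrightarrow> t_fin n m = 0"
  by (simp_all add: zeta_fin_def t_fin_def decreasing_tuples_empty)

end

theory Submission
  imports Defs "HOL-Analysis.Analysis"
begin

text \<open>
  The sums are boundary values of the Taylor series of \<open>arcsin\<^sup>m z / m!\<close>. Substituting
  \<open>z = sin \<theta>\<close> turns the operator \<open>(1 - z\<^sup>2) D\<^sup>2 - z D\<close> into the second derivative in \<open>\<theta>\<close>, so this
  operator maps the \<open>m\<close>-th series to the \<open>(m-2)\<close>-th; the resulting coefficient recurrence is
  solved by central binomial coefficients times finite repeated-2 sums. The coefficients are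
  nonnegative, so boundedness on \<open>[0, 1)\<close> makes the series absolutely convergent for
  \<open>norm z = 1\<close>. The values at \<open>z = 1\<close> and \<open>z = \<i>\<close> (where \<open>\<theta>\<close> is \<open>\<pi>/2\<close> and \<open>\<i> L\<close>) then
  separate the residue classes modulo 4 of the exponent.
\<close>

section \<open>Taylor coefficients: recurrence, bounds, parity\<close>

text \<open>Coefficient of \<open>z ^ n\<close> in \<open>arcsin z ^ m / m!\<close>. The base values
  are those of the function and its first derivative at 0. In the differential equation the operator
  contributes \<open>(n+1)(n+2)\<close> times the coefficient at \<open>n + 2\<close> and
  \<open>-n^2\<close> times the one at \<open>n\<close>.\<close>

fun arcsin_coeff :: "nat \<Rightarrow> nat \<Rightarrow> real" where
  "arcsin_coeff m 0 = (if m = 0 then 1 else 0)"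
| "arcsin_coeff m (Suc 0) = (if m = 1 then 1 else 0)"
| "arcsin_coeff m (Suc (Suc n)) =
     ((real n)\<^sup>2 * arcsin_coeff m n + (if m < 2 then 0 else arcsin_coeff (m - 2) n)) /
     (real (Suc n) * real (Suc (Suc n)))"

text \<open>The induction closes because \<open>n^2 + 1 \<le> (n+1)(n+2)\<close>. The upper bound
  yields convergence in the open disc; nonnegativity is what later reaches its boundary.\<close>

lemma arcsin_coeff_bounds: "0 \<le> arcsin_coeff m n \<and> arcsin_coeff m n \<le> 1"
proof (induction m n rule: arcsin_coeff.induct)
  case (3 m n)
  have "(real n)\<^sup>2 * arcsin_coeff m n \<le> (real n)\<^sup>2 * 1"
    using 3(1) by (intro mult_left_mono) auto
  moreover have "(if m < 2 then 0 else arcsin_coeff (m - 2) n) \<le> 1"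
    using 3 by auto
  moreover have "(real n)\<^sup>2 + 1 \<le> real (Suc n) * real (Suc (Suc n))"
    by (simp add: power2_eq_square algebra_simps)
  ultimately have "(real n)\<^sup>2 * arcsin_coeff m n + (if m < 2 then 0 else arcsin_coeff (m - 2) n)
      \<le> real (Suc n) * real (Suc (Suc n))"
    by linarith
  moreover have "0 \<le> (real n)\<^sup>2 * arcsin_coeff m n + (if m < 2 then 0 else arcsin_coeff (m - 2) n)"
    using 3 by auto
  ultimately show ?case
    by (simp add: divide_le_eq_1 del: of_nat_Suc)
qed auto

text \<open>The recurrence shifts \<open>m\<close> and \<open>n\<close> only by 2, so the parity of
  \<open>m + n\<close> is preserved down to the base cases.\<close>

lemma arcsin_coeff_parity: "odd (m + n) \<Longrightarrow> arcsin_coeff m n = 0"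
proof (induction m n rule: arcsin_coeff.induct)
  case (3 m n)
  then have "arcsin_coeff m n = 0" by simp
  moreover have "(if m < 2 then 0 else arcsin_coeff (m - 2) n) = 0"
    using 3 by (cases "m < 2") simp_all
  ultimately show ?case by simp
qed (auto simp: odd_pos)

section \<open>The power series and their differential equation\<close>

definition arcsin_series :: "nat \<Rightarrow> complex \<Rightarrow> complex" where
  "arcsin_series m z = (\<Sum>n. of_real (arcsin_coeff m n) * z ^ n)"

abbreviation arcsin_ccoeff :: "nat \<Rightarrow> nat \<Rightarrow> complex" where
  "arcsin_ccoeff m \<equiv> \<lambda>n. of_real (arcsin_coeff m n)"

lemma arcsin_series_summable:
  assumes "norm z < 1"
  shows "summable (\<lambda>n. arcsin_ccoeff m n * z ^ n)"
proof (rule summable_comparison_test')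
  show "summable (\<lambda>n. norm z ^ n)"
    using assms by (simp add: summable_geometric)
  show "norm (arcsin_ccoeff m n * z ^ n) \<le> norm z ^ n" if "n \<ge> 0" for n
    using arcsin_coeff_bounds[of m n]
    by (simp add: norm_mult norm_power mult_left_le_one_le)
qed

lemma arcsin_diffs_summable:
  assumes "norm z < 1"
  shows "summable (\<lambda>n. diffs (arcsin_ccoeff m) n * z ^ n)"
  using termdiff_converges[OF assms arcsin_series_summable] by blast

lemma arcsin_diffs2_summable:
  assumes "norm z < 1"
  shows "summable (\<lambda>n. diffs (diffs (arcsin_ccoeff m)) n * z ^ n)"
  using termdiff_converges[OF assms arcsin_diffs_summable] by blast

definition arcsin_series' :: "nat \<Rightarrow> complex \<Rightarrow> complex" where
  "arcsin_series' m z = (\<Sum>n. diffs (arcsin_ccoeff m) n * z ^ n)"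

definition arcsin_series'' :: "nat \<Rightarrow> complex \<Rightarrow> complex" where
  "arcsin_series'' m z = (\<Sum>n. diffs (diffs (arcsin_ccoeff m)) n * z ^ n)"

lemma DERIV_arcsin_series:
  assumes "norm z < 1"
  shows "(arcsin_series m has_field_derivative arcsin_series' m z) (at z)"
  unfolding arcsin_series_def[abs_def] arcsin_series'_def
  using termdiffs_strong'[where c = "arcsin_ccoeff m", OF arcsin_series_summable assms] .

lemma DERIV_arcsin_series':
  assumes "norm z < 1"
  shows "(arcsin_series' m has_field_derivative arcsin_series'' m z) (at z)"
  unfolding arcsin_series'_def[abs_def] arcsin_series''_def
  using termdiffs_strong'[where c = "diffs (arcsin_ccoeff m)", OF arcsin_diffs_summable assms] .

text \<open>Multiplying the coefficients by \<open>n\<close> is the operator \<open>z D\<close>; in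
  this form it can be iterated.\<close>

lemma sums_mult_diffs:
  fixes c :: "nat \<Rightarrow> complex"
  assumes "summable (\<lambda>n. diffs c n * z ^ n)"
  shows "(\<lambda>n. of_nat n * c n * z ^ n) sums (z * (\<Sum>n. diffs c n * z ^ n))"
proof -
  have "(\<lambda>n. z * (of_nat n * c n * z ^ (n - Suc 0))) sums (z * (\<Sum>n. diffs c n * z ^ n))"
    by (intro sums_mult diffs_equiv assms)
  moreover have "z * (of_nat n * c n * z ^ (n - Suc 0)) = of_nat n * c n * z ^ n" for n
    by (cases n) simp_all
  ultimately show ?thesis by simp
qed

text \<open>The recurrence says that \<open>f''\<close> equals \<open>(z D)^2 f\<close> plus the
  series for \<open>m - 2\<close>, and \<open>(z D)^2 f = z (f' + z f'')\<close>. Collecting the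
  \<open>f''\<close> terms gives the equation.\<close>

lemma arcsin_series_ode:
  assumes "norm z < 1"
  shows "(1 - z\<^sup>2) * arcsin_series'' m z - z * arcsin_series' m z =
    (if m < 2 then 0 else arcsin_series (m - 2) z)"
proof -
  let ?c = "arcsin_ccoeff m"
  define c1 where "c1 = (\<lambda>n. of_nat n * ?c n)"
  have A': "(\<lambda>n. diffs ?c n * z ^ n) sums arcsin_series' m z"
    unfolding arcsin_series'_def by (intro summable_sums arcsin_diffs_summable assms)
  \<comment> \<open>Since \<open>(n+1) + n (n+1) = (n+1)^2\<close>, adding the two series gives
    \<open>D (z D f)\<close>, whose coefficients are \<open>diffs c1\<close>.\<close>
  have "(\<lambda>n. of_nat n * diffs ?c n * z ^ n) sums (z * arcsin_series'' m z)"
    unfolding arcsin_series''_def by (intro sums_mult_diffs arcsin_diffs2_summable assms)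
  from sums_add[OF A' this]
  have c1: "(\<lambda>n. diffs c1 n * z ^ n) sums (arcsin_series' m z + z * arcsin_series'' m z)"
    by (simp add: c1_def diffs_def algebra_simps)
  have "(\<lambda>n. of_nat n * c1 n * z ^ n) sums (z * (arcsin_series' m z + z * arcsin_series'' m z))"
    using sums_mult_diffs[OF sums_summable[OF c1]] c1 by (simp add: sums_iff)
  moreover have "(\<lambda>n. (if m < 2 then 0 else arcsin_ccoeff (m - 2) n) * z ^ n) sums
      (if m < 2 then 0 else arcsin_series (m - 2) z)"
    using arcsin_series_summable[OF assms, of "m - 2"]
    by (auto simp: arcsin_series_def intro: summable_sums)
  ultimately have "(\<lambda>n. of_nat n * c1 n * z ^ n + (if m < 2 then 0 else arcsin_ccoeff (m - 2) n) * z ^ n)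
      sums (z * (arcsin_series' m z + z * arcsin_series'' m z) + (if m < 2 then 0 else arcsin_series (m - 2) z))"
    by (rule sums_add)
  moreover have "of_nat n * c1 n * z ^ n + (if m < 2 then 0 else arcsin_ccoeff (m - 2) n) * z ^ n =
      diffs (diffs ?c) n * z ^ n" for n
  proof -
    have "real (Suc n) * real (Suc (Suc n)) * arcsin_coeff m (Suc (Suc n)) =
        (real n)\<^sup>2 * arcsin_coeff m n + (if m < 2 then 0 else arcsin_coeff (m - 2) n)"
      by (simp del: of_nat_Suc)
    then have "complex_of_real (real (Suc n) * real (Suc (Suc n)) * arcsin_coeff m (Suc (Suc n))) =
        of_real ((real n)\<^sup>2 * arcsin_coeff m n + (if m < 2 then 0 else arcsin_coeff (m - 2) n))"
      by presburger
    then have "diffs (diffs ?c) n = of_nat n * c1 n + (if m < 2 then 0 else arcsin_ccoeff (m - 2) n)"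
      by (simp add: diffs_def c1_def power2_eq_square mult_ac
            del: of_nat_Suc arcsin_coeff.simps split: if_splits)
    then show ?thesis by (simp add: algebra_simps)
  qed
  ultimately have "arcsin_series'' m z =
      z * (arcsin_series' m z + z * arcsin_series'' m z) + (if m < 2 then 0 else arcsin_series (m - 2) z)"
    unfolding arcsin_series''_def by (simp add: sums_iff)
  then show ?thesis
    by (simp add: algebra_simps power2_eq_square)
qed

lemma arcsin_series_at_0: "arcsin_series m 0 = (if m = 0 then 1 else 0)"
  unfolding arcsin_series_def by (subst powser_zero) simp

lemma arcsin_series'_at_0: "arcsin_series' m 0 = (if m = 1 then 1 else 0)"
  unfolding arcsin_series'_def by (subst powser_zero) (simp add: diffs_def)

section \<open>The substitution z = sin \<theta> on segments\<close>

text \<open>Derivatives are taken within \<open>S\<close> because \<open>S\<close> will be a real or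
  imaginary segment, which has empty interior in the complex plane.\<close>

lemma eq_on_convex_if_derivs_eq:
  fixes f g :: "complex \<Rightarrow> complex"
  assumes "convex S" "a \<in> S" "z \<in> S" "f a = g a"
    and "\<And>x. x \<in> S \<Longrightarrow> (f has_field_derivative d x) (at x within S)"
    and "\<And>x. x \<in> S \<Longrightarrow> (g has_field_derivative d x) (at x within S)"
  shows "f z = g z"
proof -
  have "\<exists>c. \<forall>x\<in>S. f x - g x = c"
  proof (rule has_field_derivative_zero_constant[OF \<open>convex S\<close>])
    show "((\<lambda>x. f x - g x) has_field_derivative 0) (at x within S)" if "x \<in> S" for x
      using DERIV_diff[OF assms(5)[OF that] assms(6)[OF that]] by simp
  qed
  then have "f z - g z = f a - g a"
    using assms(2,3) by metis
  then show ?thesis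
    using assms(4) by simp
qed

lemma DERIV_power_over_fact:
  "((\<lambda>x. x ^ m / fact m) has_field_derivative
     (if m = 0 then 0 else x ^ (m - 1) / fact (m - 1))) (at (x::complex) within S)"
proof (cases m)
  case (Suc k)
  have "((\<lambda>x. x ^ m / fact m) has_field_derivative (of_nat m * x ^ (m - 1)) / fact m) (at x within S)"
    by (auto intro!: derivative_eq_intros)
  also have "of_nat m * x ^ (m - 1) / fact m = x ^ (m - 1) / fact (m - 1)"
    using Suc by (simp add: field_simps del: of_nat_Suc)
  finally show ?thesis using Suc by simp
qed simp

text \<open>Strong induction on \<open>m\<close>: by the differential equation the second derivative
  in \<theta> of the left side is the case \<open>m - 2\<close>, or 0 if \<open>m < 2\<close>. Two
  integrations from 0 recover the claim.\<close>

lemma arcsin_series_sin: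
  assumes "convex S" "0 \<in> S" "\<And>\<theta>. \<theta> \<in> S \<Longrightarrow> norm (sin \<theta>) < 1" "\<theta> \<in> S"
  shows "arcsin_series m (sin \<theta>) = \<theta> ^ m / fact m"
  using \<open>\<theta> \<in> S\<close>
proof (induction m arbitrary: \<theta> rule: less_induct)
  case (less m)
  let ?p = "\<lambda>x::complex. if m = 0 then 0 else x ^ (m - 1) / fact (m - 1)"
  let ?q = "\<lambda>x::complex. if m < 2 then 0 else x ^ (m - 2) / fact (m - 2)"
  \<comment> \<open>First integration: both sides have derivative \<open>?q\<close>, and at 0 both
    are 1 for \<open>m = 1\<close> and 0 otherwise.\<close>
  have eq1: "cos x * arcsin_series' m (sin x) = ?p x" if "x \<in> S" for x
  proof (rule eq_on_convex_if_derivs_eq[OF assms(1,2) that, where d = ?q and f = "\<lambda>x. cos x * arcsin_series' m (sin x)"])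
    fix y assume y: "y \<in> S"
    let ?z = "sin y"
    have "((\<lambda>x. arcsin_series' m (sin x)) has_field_derivative arcsin_series'' m ?z * cos y) (at y within S)"
      using DERIV_chain2[OF DERIV_arcsin_series'[OF assms(3)[OF y]] DERIV_subset[OF DERIV_sin, of S]]
      by auto
    from DERIV_mult[OF DERIV_subset[OF DERIV_cos] this]
    have "((\<lambda>x. cos x * arcsin_series' m (sin x)) has_field_derivative
        (- ?z * arcsin_series' m ?z + arcsin_series'' m ?z * cos y * cos y)) (at y within S)"
      by simp
    also have "- ?z * arcsin_series' m ?z + arcsin_series'' m ?z * cos y * cos y =
        (1 - ?z\<^sup>2) * arcsin_series'' m ?z - ?z * arcsin_series' m ?z"
      by (simp flip: cos_squared_eq add: power2_eq_square[of "cos y"])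
    also have "\<dots> = (if m < 2 then 0 else arcsin_series (m - 2) ?z)"
      by (rule arcsin_series_ode[OF assms(3)[OF y]])
    also have "\<dots> = ?q y"
      using less.IH[of "m - 2", OF _ y] by simp
    finally show "((\<lambda>x. cos x * arcsin_series' m (sin x)) has_field_derivative ?q y) (at y within S)" .
    show "(?p has_field_derivative ?q y) (at y within S)"
    proof (cases "m = 0")
      case False
      then show ?thesis
        using DERIV_power_over_fact[of "m - 1" y S] by (auto simp: numeral_2_eq_2 split: if_splits)
    qed simp
  qed (auto simp: arcsin_series'_at_0)
  show ?case
  \<comment> \<open>Second integration: \<open>eq1\<close> identifies the derivative of the left
    side, and at 0 both sides are 1 for \<open>m = 0\<close> and 0 otherwise.\<close>
  proof (rule eq_on_convex_if_derivs_eq[OF assms(1,2) less.prems, where d = ?p and f = "\<lambda>x. arcsin_series m (sin x)"])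
    fix y assume y: "y \<in> S"
    have "((\<lambda>x. arcsin_series m (sin x)) has_field_derivative arcsin_series' m (sin y) * cos y) (at y within S)"
      using DERIV_chain2[OF DERIV_arcsin_series[OF assms(3)[OF y]] DERIV_subset[OF DERIV_sin, of S]]
      by auto
    then show "((\<lambda>x. arcsin_series m (sin x)) has_field_derivative ?p y) (at y within S)"
      using eq1[OF y] by (simp add: mult.commute)
    show "((\<lambda>x. x ^ m / fact m) has_field_derivative ?p y) (at y within S)"
      by (rule DERIV_power_over_fact)
  qed (auto simp: arcsin_series_at_0 power_0_left)
qed

lemma arcsin_series_sin_real:
  assumes "0 \<le> t" "t < pi / 2"
  shows "arcsin_series m (of_real (sin t)) = of_real t ^ m / fact m"
proof -
  have "arcsin_series m (sin (of_real t)) = of_real t ^ m / fact m"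
  proof (rule arcsin_series_sin)
    \<comment> \<open>The half-open segment keeps the sine inside the open disc; its missing
      endpoint is where the sine reaches 1.\<close>
    show "convex (complex_of_real ` {0..<pi/2})"
      by (intro convex_linear_image) (simp_all add: linear_of_real)
    show "norm (sin \<theta>) < 1" if "\<theta> \<in> complex_of_real ` {0..<pi/2}" for \<theta>
    proof -
      from that obtain x where x: "0 \<le> x" "x < pi/2" "\<theta> = of_real x" by auto
      have "0 \<le> sin x" using x by (intro sin_ge_zero) auto
      moreover have "sin x < sin (pi / 2)" using x by (intro sin_monotone_2pi) auto
      ultimately show ?thesis using x by (simp add: sin_of_real del: norm_of_real) simp
    qed
  qed (use assms in auto)
  then show ?thesis by (simp add: sin_of_real)
qed

lemma sin_i_times: "sin (\<i> * of_real t) = \<i> * of_real (sinh t)"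
  by (simp add: complex_eq_iff Re_sin Im_sin sinh_def)

text \<open>On the imaginary axis the sine is \<i> times a hyperbolic sine, and
  \<open>arsinh 1\<close> is the parameter at which it reaches the unit circle, at \<i>.\<close>

lemma arcsin_series_sin_imag:
  assumes "0 \<le> t" "t < arsinh 1"
  shows "arcsin_series m (\<i> * of_real (sinh t)) = (\<i> * of_real t) ^ m / fact m"
proof -
  let ?S = "(\<lambda>x. \<i> * complex_of_real x) ` {0..<arsinh 1}"
  have "arcsin_series m (sin (\<i> * of_real t)) = (\<i> * of_real t) ^ m / fact m"
  proof (rule arcsin_series_sin)
    have "linear (\<lambda>x. \<i> * complex_of_real x)"
      by (rule linearI) (simp_all add: algebra_simps scaleR_conv_of_real)
    then show "convex ?S"
      by (intro convex_linear_image) simp_all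
    show "norm (sin \<theta>) < 1" if "\<theta> \<in> ?S" for \<theta>
    proof -
      from that obtain x where x: "0 \<le> x" "x < arsinh 1" "\<theta> = \<i> * of_real x" by auto
      have "sinh x < sinh (arsinh (1::real))" using x(2) by (simp del: sinh_arsinh_real)
      then show ?thesis using x by (simp add: sin_i_times norm_mult)
    qed
    show "0 \<in> ?S" using assms by (auto intro!: image_eqI[of _ _ 0])
  qed (use assms in auto)
  then show ?thesis by (simp add: sin_i_times)
qed

section \<open>Convergence and values on the unit circle\<close>

text \<open>By nonnegativity each partial sum at \<open>sin t\<close> is at most the full series
  \<open>t ^ m / fact m\<close>, hence at most \<open>(pi / 2) ^ m\<close>. A partial sum is a
  polynomial, so the bound survives \<open>t\<close> tending to \<open>pi / 2\<close>.\<close>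

lemma arcsin_coeff_summable: "summable (arcsin_coeff m)"
proof (rule summableI_nonneg_bounded)
  show "0 \<le> arcsin_coeff m n" for n using arcsin_coeff_bounds by blast
  show "sum (arcsin_coeff m) {..<N} \<le> (pi / 2) ^ m" for N
  proof -
    let ?P = "\<lambda>x. \<Sum>n<N. arcsin_coeff m n * x ^ n"
    have bound: "?P (sin t) \<le> (pi / 2) ^ m" if t: "0 \<le> t" "t < pi / 2" for t
    proof -
      have sn: "0 \<le> sin t" using t by (intro sin_ge_zero) auto
      have "sin t < sin (pi / 2)" using t by (intro sin_monotone_2pi) auto
      then have lt: "sin t < 1" by simp
      have "summable (\<lambda>n. arcsin_ccoeff m n * of_real (sin t) ^ n)"
        using sn lt by (intro arcsin_series_summable) auto
      then have "(\<lambda>n. complex_of_real (arcsin_coeff m n * sin t ^ n)) sums of_real (t ^ m / fact m)"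
        using arcsin_series_sin_real[OF t, of m] by (simp add: arcsin_series_def sums_iff)
      then have s: "(\<lambda>n. arcsin_coeff m n * sin t ^ n) sums (t ^ m / fact m)"
        by (simp only: sums_of_real_iff)
      then have "?P (sin t) \<le> (\<Sum>n. arcsin_coeff m n * sin t ^ n)"
        using sn arcsin_coeff_bounds by (intro sum_le_suminf) (auto simp: sums_iff)
      also have "\<dots> = t ^ m / fact m" using s by (simp add: sums_iff)
      also have "\<dots> \<le> t ^ m"
        using t fact_ge_1[of m, where 'a = real] by (simp add: divide_le_eq mult_le_cancel_left1)
      also have "\<dots> \<le> (pi / 2) ^ m" using t by (intro power_mono) auto
      finally show ?thesis .
    qed
    have "((\<lambda>t. ?P (sin t)) \<longlongrightarrow> ?P (sin (pi / 2))) (at_left (pi / 2))"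
      by (intro tendsto_intros)
    moreover have "\<forall>\<^sub>F t in at_left (pi / 2). ?P (sin t) \<le> (pi / 2) ^ m"
      by (rule eventually_mono[OF eventually_at_left_real[of 0 "pi / 2"]]) (use bound in auto)
    ultimately have "?P (sin (pi / 2)) \<le> (pi / 2) ^ m"
      by (rule tendsto_upperbound) simp
    then show ?thesis by simp
  qed
qed

text \<open>The coefficients themselves form a summable majorant on the closed disc, so convergence
  there is uniform.\<close>

lemma continuous_on_arcsin_series: "continuous_on (cball 0 1) (arcsin_series m)"
proof -
  have "uniform_limit (cball 0 1) (\<lambda>N z. \<Sum>n<N. arcsin_ccoeff m n * z ^ n)
      (\<lambda>z. \<Sum>n. arcsin_ccoeff m n * z ^ n) sequentially"
  proof (rule Weierstrass_m_test[OF _ arcsin_coeff_summable[of m]])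
    fix n and z :: complex assume "z \<in> cball 0 1"
    then have "norm z ^ n \<le> 1" by (simp add: power_le_one)
    then show "norm (arcsin_ccoeff m n * z ^ n) \<le> arcsin_coeff m n"
      using arcsin_coeff_bounds[of m n] by (simp add: norm_mult norm_power mult_left_le)
  qed
  then show ?thesis
    unfolding arcsin_series_def[abs_def]
    by (rule uniform_limit_theorem[rotated]) (auto intro!: always_eventually continuous_intros)
qed

lemma tendsto_arcsin_series:
  assumes "(f \<longlongrightarrow> z) F" "norm z \<le> 1" "\<forall>\<^sub>F t in F. norm (f t) \<le> 1"
  shows "((\<lambda>t. arcsin_series m (f t)) \<longlongrightarrow> arcsin_series m z) F"
  using continuous_on_tendsto_compose[OF continuous_on_arcsin_series assms(1)] assms(2,3) by simp

text \<open>Along the segment the limit is computed twice: by continuity on the closed disc, and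
  from the identity inside the disc. The value at \<i> is obtained likewise on the imaginary
  axis.\<close>

lemma arcsin_series_1: "arcsin_series m 1 = of_real ((pi / 2) ^ m / fact m)"
proof (rule tendsto_unique)
  let ?f = "\<lambda>t. arcsin_series m (of_real (sin t))"
  have "((\<lambda>t. of_real (sin t)) \<longlongrightarrow> complex_of_real (sin (pi / 2))) (at_left (pi / 2))"
    by (intro tendsto_intros)
  then show "(?f \<longlongrightarrow> arcsin_series m 1) (at_left (pi / 2))"
    by (intro tendsto_arcsin_series) auto
  have "\<forall>\<^sub>F t in at_left (pi / 2). of_real (t ^ m / fact m) = ?f t"
    by (rule eventually_mono[OF eventually_at_left_real[of 0 "pi / 2"]])
       (auto simp: arcsin_series_sin_real)
  moreover have "((\<lambda>t. complex_of_real (t ^ m / fact m)) \<longlongrightarrow> of_real ((pi / 2) ^ m / fact m)) (at_left (pi / 2))"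
    by (intro tendsto_intros) auto
  ultimately show "(?f \<longlongrightarrow> of_real ((pi / 2) ^ m / fact m)) (at_left (pi / 2))"
    by (rule Lim_transform_eventually[rotated])
qed simp

lemma arcsin_series_i: "arcsin_series m \<i> = (\<i> * of_real (arsinh 1)) ^ m / fact m"
proof (rule tendsto_unique)
  let ?L = "arsinh 1 :: real"
  let ?f = "\<lambda>t. arcsin_series m (\<i> * of_real (sinh t))"
  have L0: "0 < ?L" by simp
  have ev: "\<forall>\<^sub>F t in at_left ?L. t \<in> {0<..<?L}"
    using eventually_at_left_real[OF L0] .
  have "((\<lambda>t. \<i> * of_real (sinh t)) \<longlongrightarrow> \<i> * complex_of_real (sinh ?L)) (at_left ?L)"
    by (intro tendsto_intros)
  moreover have "\<forall>\<^sub>F t in at_left ?L. norm (\<i> * complex_of_real (sinh t)) \<le> 1"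
    using ev
  proof (rule eventually_mono)
    fix t assume t: "t \<in> {0<..<?L}"
    then have "sinh t < sinh ?L" by (simp del: sinh_arsinh_real)
    then show "norm (\<i> * complex_of_real (sinh t)) \<le> 1" using t by (simp add: norm_mult)
  qed
  ultimately show "(?f \<longlongrightarrow> arcsin_series m \<i>) (at_left ?L)"
    by (intro tendsto_arcsin_series) auto
  have "\<forall>\<^sub>F t in at_left ?L. (\<i> * of_real t) ^ m / fact m = ?f t"
    using ev by (rule eventually_mono) (auto simp: arcsin_series_sin_imag)
  moreover have "((\<lambda>t. (\<i> * of_real t) ^ m / fact m) \<longlongrightarrow> (\<i> * of_real ?L) ^ m / fact m) (at_left ?L)"
    by (intro tendsto_intros) auto
  ultimately show "(?f \<longlongrightarrow> (\<i> * of_real ?L) ^ m / fact m) (at_left ?L)"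
    by (rule Lim_transform_eventually[rotated])
qed simp

lemma arcsin_coeff_sums: "arcsin_coeff m sums ((pi / 2) ^ m / fact m)"
proof -
  have "(\<Sum>n. arcsin_ccoeff m n) = of_real (suminf (arcsin_coeff m))"
    by (rule suminf_of_real[OF arcsin_coeff_summable, symmetric])
  then have "complex_of_real (suminf (arcsin_coeff m)) = of_real ((pi / 2) ^ m / fact m)"
    using arcsin_series_1[of m] by (simp add: arcsin_series_def)
  then have "suminf (arcsin_coeff m) = (pi / 2) ^ m / fact m"
    by (simp only: of_real_eq_iff)
  then show ?thesis using summable_sums[OF arcsin_coeff_summable, of m] by simp
qed

lemma arcsin_coeff_sums_i:
  "(\<lambda>n. arcsin_ccoeff m n * \<i> ^ n) sums ((\<i> * of_real (arsinh 1)) ^ m / fact m)"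
proof -
  have "summable (\<lambda>n. arcsin_ccoeff m n * \<i> ^ n)"
    by (rule summable_norm_cancel, simp add: norm_mult norm_power)
       (use arcsin_coeff_bounds arcsin_coeff_summable in simp)
  then show ?thesis
    using arcsin_series_i[of m] by (simp add: arcsin_series_def sums_iff)
qed

section \<open>Recurrences for the finite repeated-2 sums\<close>

text \<open>Split on the head, which is the largest entry: unless it is \<open>Suc n\<close>, the
  whole tuple lies in \<open>{1..n}\<close>; otherwise its tail does.\<close>

lemma decreasing_tuples_Suc_Suc:
  "decreasing_tuples (Suc n) (Suc m) =
     decreasing_tuples n (Suc m) \<union> (#) (Suc n) ` decreasing_tuples n m"
proof (intro set_eqI iffI)
  fix ns assume ns: "ns \<in> decreasing_tuples (Suc n) (Suc m)"
  then obtain k ks where kks: "ns = k # ks" "length ks = m"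
    by (auto simp: decreasing_tuples_def length_Suc_conv)
  with ns have "\<forall>x\<in>set ks. x < k \<and> 1 \<le> x" "sorted_wrt (>) ks" "1 \<le> k" "k \<le> Suc n"
    by (auto simp: decreasing_tuples_def)
  then show "ns \<in> decreasing_tuples n (Suc m) \<union> (#) (Suc n) ` decreasing_tuples n m"
    using kks by (cases "k = Suc n") (fastforce simp: decreasing_tuples_def)+
qed (fastforce simp: decreasing_tuples_def)

text \<open>The weight is left general so that one recurrence serves both \<open>t_fin\<close> and
  \<open>zeta_fin\<close>.\<close>

lemma sum_decreasing_tuples_Suc_Suc:
  fixes w :: "nat \<Rightarrow> real"
  shows "(\<Sum>ns\<in>decreasing_tuples (Suc n) (Suc m). \<Prod>k\<leftarrow>ns. w k) =
    (\<Sum>ns\<in>decreasing_tuples n (Suc m). \<Prod>k\<leftarrow>ns. w k) +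
    w (Suc n) * (\<Sum>ns\<in>decreasing_tuples n m. \<Prod>k\<leftarrow>ns. w k)"
proof -
  have "decreasing_tuples n (Suc m) \<inter> (#) (Suc n) ` decreasing_tuples n m = {}"
    by (auto simp: decreasing_tuples_def)
  then show ?thesis
    unfolding decreasing_tuples_Suc_Suc
    by (simp add: sum.union_disjoint sum.reindex sum_distrib_left)
qed

lemma t_fin_Suc:
  "t_fin (Suc n) m = t_fin n m + (if m = 0 then 0 else t_fin n (m - 1) / (real (2 * n + 1))\<^sup>2)"
proof (cases m)
  case (Suc k)
  then show ?thesis
    unfolding t_fin_def
    by (simp only: sum_decreasing_tuples_Suc_Suc) (simp add: algebra_simps)
qed simp

lemma zeta_fin_Suc:
  "zeta_fin (Suc n) m = zeta_fin n m + (if m = 0 then 0 else zeta_fin n (m - 1) / (real (Suc n))\<^sup>2)"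
proof (cases m)
  case (Suc k)
  then show ?thesis
    unfolding zeta_fin_def
    by (simp only: sum_decreasing_tuples_Suc_Suc) (simp add: algebra_simps)
qed simp

section \<open>Closed forms of the coefficients\<close>

text \<open>Two absorption identities joined by the symmetry of row \<open>2 * n + 1\<close>. This
  supplies the ratio of successive prefactors in both closed forms.\<close>

lemma central_binomial_Suc:
  "real ((2 * Suc n) choose Suc n) * real (Suc n) = real ((2 * n) choose n) * (2 * (2 * real n + 1))"
proof -
  have "Suc n * ((2 * Suc n) choose Suc n) = (2 * n + 2) * (Suc (2 * n) choose n)"
    using Suc_times_binomial_eq[of "Suc (2 * n)" n] by (simp add: mult_ac)
  moreover have "Suc n * (Suc (2 * n) choose Suc n) = Suc (2 * n) * ((2 * n) choose n)"
    using Suc_times_binomial_eq[of "2 * n" n] by (simp add: mult_ac)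
  moreover have "Suc (2 * n) choose Suc n = Suc (2 * n) choose n"
    using binomial_symmetric[of n "Suc (2 * n)"] by (simp add: Suc_diff_le)
  ultimately have "((2 * Suc n) choose Suc n) * Suc n = ((2 * n) choose n) * (2 * (2 * n + 1))"
    by (simp add: algebra_simps)
  then have "real (((2 * Suc n) choose Suc n) * Suc n) = real (((2 * n) choose n) * (2 * (2 * n + 1)))"
    by (rule arg_cong)
  then show ?thesis
    by (simp add: algebra_simps del: binomial_Suc_Suc)
qed

lemma arcsin_coeff_rec:
  "arcsin_coeff m (n + 2) * ((real n + 1) * (real n + 2)) =
     (real n)\<^sup>2 * arcsin_coeff m n + (if m < 2 then 0 else arcsin_coeff (m - 2) n)"
proof -
  have "n + 2 = Suc (Suc n)" "real n + 1 = real (Suc n)" "real n + 2 = real (Suc (Suc n))"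
    by simp_all
  then show ?thesis
    by (simp only: arcsin_coeff.simps) (simp del: of_nat_Suc)
qed

lemma arcsin_coeff_0: "arcsin_coeff 0 n = (if n = 0 then 1 else 0)"
  by (induction n rule: induct_nat_012) simp_all

text \<open>The prefactor is the case \<open>m = 0\<close>, arcsin itself, and solves the recurrence
  without source. Dividing by it leaves a recurrence with source divided by \<open>(2n+1)^2\<close>,
  which is that of \<open>t_fin\<close>.\<close>

lemma arcsin_coeff_odd:
  "arcsin_coeff (2 * m + 1) (2 * n + 1) =
     real ((2 * n) choose n) / (4 ^ n * real (2 * n + 1)) * t_fin n m"
proof (induction n arbitrary: m)
  case 0
  then show ?case by (cases m) (auto simp: fin_sums_eq_0)
next
  case (Suc n)
  let ?c = "\<lambda>n. real ((2 * n) choose n) / (4 ^ n * real (2 * n + 1))"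
  have c: "?c (Suc n) * ((2 * real n + 2) * (2 * real n + 3)) = (real (2 * n + 1))\<^sup>2 * ?c n"
  proof -
    have "?c (Suc n) * ((2 * real n + 2) * (2 * real n + 3)) =
        (real ((2 * Suc n) choose Suc n) * real (Suc n)) / (2 * 4 ^ n)"
      by (simp add: divide_simps del: binomial_Suc_Suc) (simp add: algebra_simps)
    also have "\<dots> = (real (2 * n + 1))\<^sup>2 * ?c n"
      unfolding central_binomial_Suc by (simp add: divide_simps power2_eq_square)
    finally show ?thesis .
  qed
  let ?q = "real (2 * n + 1)" and ?K = "(2 * real n + 2) * (2 * real n + 3)"
  have q: "?q \<noteq> 0" and K: "?K \<noteq> 0"
    by (simp_all add: add_nonneg_eq_0_iff)
  \<comment> \<open>For \<open>m = 0\<close> the first argument is 1, below 2, so there is no source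
    term.\<close>
  have "arcsin_coeff (2 * m + 1) (2 * Suc n + 1) * ?K =
      ?q\<^sup>2 * arcsin_coeff (2 * m + 1) (2 * n + 1) +
      (if m = 0 then 0 else arcsin_coeff (2 * (m - 1) + 1) (2 * n + 1))"
    using arcsin_coeff_rec[of "2 * m + 1" "2 * n + 1"]
    by (cases m) (simp_all add: add.commute del: arcsin_coeff.simps)
  also have "\<dots> = ?q\<^sup>2 * ?c n * (t_fin n m + (if m = 0 then 0 else t_fin n (m - 1) / ?q\<^sup>2))"
    using q unfolding Suc.IH by (simp add: field_simps del: of_nat_add of_nat_mult of_nat_Suc)
  also have "\<dots> = ?c (Suc n) * t_fin (Suc n) m * ?K"
    unfolding t_fin_Suc[symmetric]
    using arg_cong[OF c, of "\<lambda>x. x * t_fin (Suc n) m"] by (simp only: mult_ac)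
  finally show ?case
    by (rule mult_right_cancel[OF K, THEN iffD1])
qed

text \<open>Same method, with \<open>m\<close> shifted by one because the series for 0 is constant.
  The source is divided by \<open>(2n+2)^2 = 4 (n+1)^2\<close>, so each level brings a factor 1/4;
  the level \<open>m = 0\<close> already carries one.\<close>

lemma arcsin_coeff_even:
  "arcsin_coeff (2 * m + 2) (2 * n + 2) =
     4 ^ Suc n / ((real (Suc n))\<^sup>2 * real ((2 * Suc n) choose Suc n)) * zeta_fin n m / 4 ^ Suc m"
proof (induction n arbitrary: m)
  case 0
  then show ?case by (cases m) (auto simp: fin_sums_eq_0 numeral_2_eq_2)
next
  case (Suc n)
  let ?B = "\<lambda>n. real ((2 * n) choose n)"
  let ?d = "\<lambda>n. 4 ^ Suc n / ((real (Suc n))\<^sup>2 * ?B (Suc n))"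
  have nz: "?B k \<noteq> 0" for k
    by simp
  have d: "?d (Suc n) * ((2 * real n + 3) * (2 * real n + 4)) = (2 * real n + 2)\<^sup>2 * ?d n"
  proof -
    have "?d (Suc n) * ((2 * real n + 3) * (2 * real n + 4)) =
        8 * 4 ^ Suc n * (2 * real n + 3) / (?B (Suc (Suc n)) * real (Suc (Suc n)))"
      using nz[of "Suc (Suc n)"]
      by (simp add: divide_simps power2_eq_square del: binomial_Suc_Suc mult_Suc_right)
    also have "\<dots> = 4 * 4 ^ Suc n / ?B (Suc n)"
      unfolding central_binomial_Suc[of "Suc n"] using nz[of "Suc n"]
      by (simp add: divide_simps del: binomial_Suc_Suc mult_Suc_right)
    also have "\<dots> = (2 * real n + 2)\<^sup>2 * ?d n"
      using nz[of "Suc n"]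
      by (simp add: divide_simps power2_eq_square del: binomial_Suc_Suc mult_Suc_right)
        (simp add: algebra_simps)
    finally show ?thesis .
  qed
  let ?q = "real (Suc n)" and ?K = "(2 * real n + 3) * (2 * real n + 4)"
  have q: "?q \<noteq> 0" and K: "?K \<noteq> 0"
    by (simp_all add: add_nonneg_eq_0_iff)
  \<comment> \<open>For \<open>m = 0\<close> the source is a coefficient of the constant series at a
    positive index, hence 0.\<close>
  have "arcsin_coeff (2 * m + 2) (2 * Suc n + 2) * ?K =
      4 * ?q\<^sup>2 * arcsin_coeff (2 * m + 2) (2 * n + 2) +
      (if m = 0 then 0 else arcsin_coeff (2 * (m - 1) + 2) (2 * n + 2))"
    using arcsin_coeff_rec[of "2 * m + 2" "2 * n + 2"]
    by (cases m) (simp_all add: arcsin_coeff_0 algebra_simps power2_eq_square del: arcsin_coeff.simps)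
  also have "\<dots> = 4 * ?q\<^sup>2 * ?d n * (zeta_fin n m + (if m = 0 then 0 else zeta_fin n (m - 1) / ?q\<^sup>2)) / 4 ^ Suc m"
    using q unfolding Suc.IH
    by (cases m) (simp_all add: divide_simps ring_distribs del: of_nat_Suc binomial_Suc_Suc mult_Suc_right)
  also have "\<dots> = ?d (Suc n) * ?K * zeta_fin (Suc n) m / 4 ^ Suc m"
    unfolding zeta_fin_Suc[symmetric] d
    by (simp add: power2_eq_square algebra_simps del: binomial_Suc_Suc mult_Suc_right)
  finally have "arcsin_coeff (2 * m + 2) (2 * Suc n + 2) * ?K = (?d (Suc n) * zeta_fin (Suc n) m / 4 ^ Suc m) * ?K"
    by (simp only: mult_ac times_divide_eq_left times_divide_eq_right)
  then show ?case
    by (rule mult_right_cancel[OF K, THEN iffD1])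
qed

section \<open>Separation of residue classes modulo 4\<close>

text \<open>Combining the values at 1 and \<i> weights the coefficient at \<open>n\<close> by
  \<open>1 + s j * s n\<close>. Among indices of the parity of \<open>m\<close> this is 2 on the
  class of \<open>j\<close> and 0 on the other class; coefficients of the wrong parity
  vanish.\<close>

lemma arcsin_coeff_sums_mod_4:
  assumes "j < 4" "odd j \<longleftrightarrow> odd m"
  shows "(\<lambda>r. 2 * arcsin_coeff m (4 * r + j)) sums
    (((pi / 2) ^ m + (- 1) ^ (m div 2 + j div 2) * arsinh 1 ^ m) / fact m)"
proof -
  let ?c = "arcsin_coeff m"
  define s :: "nat \<Rightarrow> real" where "s n = (- 1) ^ (n div 2)" for n
  have i: "\<i> ^ n = of_real (s n) * (if odd n then \<i> else 1)" for n
    by (cases "even n") (auto elim!: evenE oddE simp: s_def power_mult)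
  have "(\<lambda>n. of_real (s n * ?c n)) sums (of_real (s m * arsinh 1 ^ m / fact m) :: complex)"
  proof -
    \<comment> \<open>By parity this factor is common to all nonzero terms and to the value;
      cancelling it leaves a real series.\<close>
    let ?u = "if odd m then \<i> else 1"
    have "(\<lambda>n. arcsin_ccoeff m n * \<i> ^ n) = (\<lambda>n. of_real (s n * ?c n) * ?u)"
    proof
      show "arcsin_ccoeff m n * \<i> ^ n = of_real (s n * ?c n) * ?u" for n
        using arcsin_coeff_parity[of m n] by (cases "odd (m + n)") (auto simp: i)
    qed
    moreover have "(\<i> * of_real (arsinh 1)) ^ m / fact m = of_real (s m * arsinh 1 ^ m / fact m) * ?u"
      by (simp add: power_mult_distrib i)
    ultimately have "(\<lambda>n. of_real (s n * ?c n) * ?u) sums (of_real (s m * arsinh 1 ^ m / fact m) * ?u)"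
      using arcsin_coeff_sums_i[of m] by (simp only:)
    then show ?thesis
      by (rule sums_mult2_iff[THEN iffD1, rotated]) simp
  qed
  then have "(\<lambda>n. s n * ?c n) sums (s m * arsinh 1 ^ m / fact m)"
    by (simp only: sums_of_real_iff)
  from sums_add[OF arcsin_coeff_sums sums_mult[OF this, of "s j"]]
  have *: "(\<lambda>n. ?c n + s j * (s n * ?c n)) sums
      (((pi / 2) ^ m + s j * s m * arsinh 1 ^ m) / fact m)"
    by (simp add: add_divide_distrib mult.assoc)
  have "(\<lambda>r. ?c (4 * r + j) + s j * (s (4 * r + j) * ?c (4 * r + j))) sums
      (((pi / 2) ^ m + s j * s m * arsinh 1 ^ m) / fact m)"
  proof (subst sums_mono_reindex[where g = "\<lambda>r. 4 * r + j" and f = "\<lambda>n. ?c n + s j * (s n * ?c n)", unfolded o_def])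
    show "strict_mono (\<lambda>r. 4 * r + j)" by (simp add: strict_mono_def)
    fix n assume n: "n \<notin> range (\<lambda>r. 4 * r + j)"
    show "?c n + s j * (s n * ?c n) = 0"
    proof (cases "odd (m + n)")
      case False
      have "n mod 4 \<noteq> j"
      proof
        assume "n mod 4 = j"
        then have "n = 4 * (n div 4) + j" by presburger
        with n show False by blast
      qed
      \<comment> \<open>Equal parity but different residues modulo 4 means a difference of 2 modulo
        4.\<close>
      with False assms have "odd (j div 2 + n div 2)" by presburger
      then have "s j * s n = - 1" by (simp add: s_def flip: power_add)
      then show ?thesis by (simp flip: mult.assoc)
    qed (simp add: arcsin_coeff_parity)
  qed (rule *)
  moreover have "s j * s (4 * r + j) = 1" for r
  proof -
    have "even (j div 2 + (4 * r + j) div 2)" by presburger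
    then show ?thesis by (simp add: s_def flip: power_add)
  qed
  moreover have "s j * s m = (- 1) ^ (m div 2 + j div 2)"
    by (simp add: s_def power_add)
  ultimately show ?thesis
    by (simp flip: mult.assoc)
qed

section \<open>Evaluation of the four sums\<close>

theorem theorem6p1:
  fixes L :: real
  assumes L: "L = arsinh 1"
  shows
    "L = ln (1 + sqrt 2) \<and>
     (\<forall>m::nat.
        (\<lambda>r. real ((4 * r) choose (2 * r)) / (16 ^ r * real (4 * r + 1)) * t_fin (2 * r) m) sums
          ((pi ^ (2 * m + 1) + (-1) ^ m * (2 * L) ^ (2 * m + 1)) / (2 ^ (2 * m + 2) * fact (2 * m + 1))) \<and>
        (\<lambda>r. real ((4 * r + 2) choose (2 * r + 1)) / (2 ^ (4 * r + 2) * real (4 * r + 3)) * t_fin (2 * r + 1) m) sums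
          ((pi ^ (2 * m + 1) - (-1) ^ m * (2 * L) ^ (2 * m + 1)) / (2 ^ (2 * m + 2) * fact (2 * m + 1)))) \<and>
     (\<forall>m::nat. m \<ge> 1 \<longrightarrow>
        (\<lambda>r. 16 ^ Suc r / ((real (Suc r))\<^sup>2 * real ((4 * Suc r) choose (2 * Suc r))) * zeta_fin (2 * Suc r - 1) (m - 1)) sums
          (2 * (pi ^ (2 * m) + (-1) ^ m * (2 * L) ^ (2 * m)) / fact (2 * m)) \<and>
        (\<lambda>r. 4 ^ (2 * r + 1) / ((real (2 * r + 1))\<^sup>2 * real ((4 * r + 2) choose (2 * r + 1))) * zeta_fin (2 * r) (m - 1)) sums
          ((pi ^ (2 * m) - (-1) ^ m * (2 * L) ^ (2 * m)) / (2 * fact (2 * m))))"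
proof (intro conjI allI impI)
  show "L = ln (1 + sqrt 2)"
    by (simp add: L arsinh_real_def)
next
  fix m :: nat
  \<comment> \<open>The sign exponent is \<open>(2 * m + 1) div 2 + 1 div 2 = m\<close>.\<close>
  have "(\<lambda>r. 2 * arcsin_coeff (2 * m + 1) (4 * r + 1) / 2) sums
      ((((pi / 2) ^ (2 * m + 1) + (- 1) ^ m * L ^ (2 * m + 1)) / fact (2 * m + 1)) / 2)"
    using arcsin_coeff_sums_mod_4[where m = "2 * m + 1" and j = 1] by (intro sums_divide) (simp add: L)
  moreover have "arcsin_coeff (2 * m + 1) (4 * r + 1) =
      real ((4 * r) choose (2 * r)) / (16 ^ r * real (4 * r + 1)) * t_fin (2 * r) m" for r
    using arcsin_coeff_odd[of m "2 * r"] by (simp add: power_mult)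
  moreover have "(((pi / 2) ^ (2 * m + 1) + (- 1) ^ m * L ^ (2 * m + 1)) / fact (2 * m + 1)) / 2 =
      (pi ^ (2 * m + 1) + (- 1) ^ m * (2 * L) ^ (2 * m + 1)) / (2 ^ (2 * m + 2) * fact (2 * m + 1))"
    by (simp add: power_divide power_mult_distrib divide_simps)
  ultimately show "(\<lambda>r. real ((4 * r) choose (2 * r)) / (16 ^ r * real (4 * r + 1)) * t_fin (2 * r) m) sums
      ((pi ^ (2 * m + 1) + (- 1) ^ m * (2 * L) ^ (2 * m + 1)) / (2 ^ (2 * m + 2) * fact (2 * m + 1)))"
    by simp
next
  fix m :: nat
  \<comment> \<open>Here \<open>3 div 2 = 1\<close> raises the exponent by one and flips the sign of
    the \<open>L\<close> term.\<close>
  have "(\<lambda>r. 2 * arcsin_coeff (2 * m + 1) (4 * r + 3) / 2) sums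
      ((((pi / 2) ^ (2 * m + 1) - (- 1) ^ m * L ^ (2 * m + 1)) / fact (2 * m + 1)) / 2)"
    using arcsin_coeff_sums_mod_4[where m = "2 * m + 1" and j = 3] by (intro sums_divide) (simp add: L)
  moreover have "arcsin_coeff (2 * m + 1) (4 * r + 3) =
      real ((4 * r + 2) choose (2 * r + 1)) / (2 ^ (4 * r + 2) * real (4 * r + 3)) * t_fin (2 * r + 1) m" for r
  proof -
    have "(4::real) ^ (2 * r + 1) = 2 ^ (4 * r + 2)"
      by (simp add: power_mult)
    moreover have "2 * (2 * r + 1) = 4 * r + 2" "4 * r + 2 + 1 = 4 * r + 3"
      by simp_all
    ultimately show ?thesis
      using arcsin_coeff_odd[of m "2 * r + 1"] by metis
  qed
  moreover have "(((pi / 2) ^ (2 * m + 1) - (- 1) ^ m * L ^ (2 * m + 1)) / fact (2 * m + 1)) / 2 =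
      (pi ^ (2 * m + 1) - (- 1) ^ m * (2 * L) ^ (2 * m + 1)) / (2 ^ (2 * m + 2) * fact (2 * m + 1))"
    by (simp add: power_divide power_mult_distrib divide_simps)
  ultimately show "(\<lambda>r. real ((4 * r + 2) choose (2 * r + 1)) / (2 ^ (4 * r + 2) * real (4 * r + 3)) * t_fin (2 * r + 1) m) sums
      ((pi ^ (2 * m + 1) - (- 1) ^ m * (2 * L) ^ (2 * m + 1)) / (2 ^ (2 * m + 2) * fact (2 * m + 1)))"
    by simp
next
  fix m :: nat assume "m \<ge> 1"
  then obtain k where k: "m = Suc k" by (cases m) auto
  let ?S = "((pi / 2) ^ (2 * m) + (- 1) ^ m * L ^ (2 * m)) / fact (2 * m)"
  have "(\<lambda>r. 2 * arcsin_coeff (2 * m) (4 * r)) sums ?S"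
    using arcsin_coeff_sums_mod_4[where m = "2 * m" and j = 0] by (simp add: L)
  \<comment> \<open>The dropped term is the coefficient at index 0, which vanishes because
    \<open>m\<close> is positive.\<close>
  then have "(\<lambda>r. 2 * arcsin_coeff (2 * m) (4 * Suc r)) sums ?S"
    using \<open>m \<ge> 1\<close> by (subst sums_Suc_iff) simp
  \<comment> \<open>The factor \<open>4 ^ m\<close> clears the power in the even closed form; the
    other 2, with the 2 already present, cancels the 4 in \<open>(2 * Suc r)^2\<close>.\<close>
  then have "(\<lambda>r. 2 * arcsin_coeff (2 * m) (4 * Suc r) * (2 * 4 ^ m)) sums (?S * (2 * 4 ^ m))"
    by (rule sums_mult2)
  moreover have "2 * arcsin_coeff (2 * m) (4 * Suc r) * (2 * 4 ^ m) =
      16 ^ Suc r / ((real (Suc r))\<^sup>2 * real ((4 * Suc r) choose (2 * Suc r))) * zeta_fin (2 * Suc r - 1) (m - 1)" for r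
  proof -
    have e: "Suc (2 * r + 1) = 2 * Suc r" "2 * (2 * Suc r) = 4 * Suc r" "2 * (2 * r + 1) + 2 = 4 * Suc r"
        "2 * k + 2 = 2 * m" "Suc k = m" "2 * r + 1 = 2 * Suc r - 1" "k = m - 1"
      using k by simp_all
    have "arcsin_coeff (2 * m) (4 * Suc r) =
        4 ^ (2 * Suc r) / ((real (2 * Suc r))\<^sup>2 * real ((4 * Suc r) choose (2 * Suc r))) * zeta_fin (2 * Suc r - 1) (m - 1) / 4 ^ m"
      using arcsin_coeff_even[of k "2 * r + 1"] by (simp only: e(1-5)) (simp only: e(6,7))
    also have "(4::real) ^ (2 * Suc r) = 16 ^ Suc r"
      by (simp only: power_mult) simp
    also have "(real (2 * Suc r))\<^sup>2 = 4 * (real (Suc r))\<^sup>2"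
      by (simp add: power2_eq_square algebra_simps)
    finally show ?thesis
      by (simp del: power_Suc binomial_Suc_Suc mult_Suc_right of_nat_Suc)
  qed
  moreover have "?S * (2 * 4 ^ m) = 2 * (pi ^ (2 * m) + (- 1) ^ m * (2 * L) ^ (2 * m)) / fact (2 * m)"
    by (simp add: power_divide power_mult_distrib power_mult divide_simps)
  ultimately show "(\<lambda>r. 16 ^ Suc r / ((real (Suc r))\<^sup>2 * real ((4 * Suc r) choose (2 * Suc r))) * zeta_fin (2 * Suc r - 1) (m - 1)) sums
      (2 * (pi ^ (2 * m) + (- 1) ^ m * (2 * L) ^ (2 * m)) / fact (2 * m))"
    by (simp only:)
next
  fix m :: nat assume "m \<ge> 1"
  then obtain k where k: "m = Suc k" by (cases m) auto
  let ?S = "((pi / 2) ^ (2 * m) - (- 1) ^ m * L ^ (2 * m)) / fact (2 * m)"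
  \<comment> \<open>Again \<open>2 div 2 = 1\<close> flips the sign.\<close>
  have "(\<lambda>r. 2 * arcsin_coeff (2 * m) (4 * r + 2)) sums ?S"
    using arcsin_coeff_sums_mod_4[where m = "2 * m" and j = 2] by (simp add: L)
  \<comment> \<open>Now \<open>2 * r + 1\<close> is squared directly, so only \<open>4 ^ m\<close>
    and the doubling have to be cleared.\<close>
  then have "(\<lambda>r. 2 * arcsin_coeff (2 * m) (4 * r + 2) * (4 ^ m / 2)) sums (?S * (4 ^ m / 2))"
    by (rule sums_mult2)
  moreover have "2 * arcsin_coeff (2 * m) (4 * r + 2) * (4 ^ m / 2) =
      4 ^ (2 * r + 1) / ((real (2 * r + 1))\<^sup>2 * real ((4 * r + 2) choose (2 * r + 1))) * zeta_fin (2 * r) (m - 1)" for r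
  proof -
    have e: "Suc (2 * r) = 2 * r + 1" "2 * (2 * r + 1) = 4 * r + 2" "2 * (2 * r) + 2 = 4 * r + 2"
        "2 * k + 2 = 2 * m" "Suc k = m" "k = m - 1"
      using k by simp_all
    have "arcsin_coeff (2 * m) (4 * r + 2) =
        4 ^ (2 * r + 1) / ((real (2 * r + 1))\<^sup>2 * real ((4 * r + 2) choose (2 * r + 1))) * zeta_fin (2 * r) (m - 1) / 4 ^ m"
      using arcsin_coeff_even[of k "2 * r"] by (simp only: e(1-5)) (simp only: e(6))
    then show ?thesis by simp
  qed
  moreover have "?S * (4 ^ m / 2) = (pi ^ (2 * m) - (- 1) ^ m * (2 * L) ^ (2 * m)) / (2 * fact (2 * m))"
    by (simp add: power_divide power_mult_distrib power_mult divide_simps)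
  ultimately show "(\<lambda>r. 4 ^ (2 * r + 1) / ((real (2 * r + 1))\<^sup>2 * real ((4 * r + 2) choose (2 * r + 1))) * zeta_fin (2 * r) (m - 1)) sums
      ((pi ^ (2 * m) - (- 1) ^ m * (2 * L) ^ (2 * m)) / (2 * fact (2 * m)))"
    by (simp only:)
qed

end
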